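(* For any spider graph $S_{1,n,n}$ on $2n+1$ vertices with $n\ge 3$, $\gamma_{tc}(M(S_{1,n,n}))=2n+2$.
   Context: All graphs are finite, simple and undirected. The spider graph $S_{1,n,n}$ is obtained from the star $K_{1,n}$ by replacing every edge with a path of length $2$; i.e., it has vertices $v_0,v_1,\dots,v_{2n}$ and edges $v_0v_i$, $v_iv_{n+i}$ for $1\le i\le n$. For a graph $H$, a set $D\subseteq V(H)$ is a total dominating set if every vertex of $H$ has a neighbor in $D$. A set $D\subseteq V(H)$ is a total outer-connected dominating set of $H$ if $D$ is a total dominating set and the induced subgraph $H[V(H)\setminus D]$ is connected; $\gamma_{tc}(H)$ denotes the minimum cardinality of a total outer-connected dominating set of $H$. The middle graph $M(G)$ of a graph $G$ has vertex set $V(G)\cup E(G)$, where two elements $x,y$ are adjacent iff either $x,y\in E(G)$ are edges of $G$ sharing an endpoint, or one of them is a vertex of $G$ and the other is an edge of $G$ incident to it. *)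

theory Defs
  imports "Graph_Theory.Graph_Theory"
begin

text \<open>
  A finite simple undirected graph is a \<^locale>\<open>pair_graph\<close>: a finite, loopfree digraph with a
  symmetric set of arcs, in which the undirected edge \<open>uv\<close> is the pair of arcs \<open>(u, v)\<close>, \<open>(v, u)\<close>.
\<close>

definition undirected_edges :: "'a pair_pre_digraph \<Rightarrow> 'a set set" where
  "undirected_edges G = {{u, v} | u v. (u, v) \<in> parcs G}"

definition spider_graph :: "nat \<Rightarrow> nat pair_pre_digraph" where
  "spider_graph n =
    \<lparr> pverts = {0..2 * n},
      parcs = (\<Union>i\<in>{1..n}. {(0, i), (i, 0), (i, n + i), (n + i, i)}) \<rparr>"

definition middle_graph :: "'a pair_pre_digraph \<Rightarrow> ('a + 'a set) pair_pre_digraph" where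
  "middle_graph G =
    \<lparr> pverts = Inl ` pverts G \<union> Inr ` undirected_edges G,
      parcs =
        {(Inr e, Inr f) | e f.
           e \<in> undirected_edges G \<and> f \<in> undirected_edges G \<and> e \<noteq> f \<and> e \<inter> f \<noteq> {}} \<union>
        {(Inl v, Inr e) | v e. v \<in> pverts G \<and> e \<in> undirected_edges G \<and> v \<in> e} \<union>
        {(Inr e, Inl v) | v e. v \<in> pverts G \<and> e \<in> undirected_edges G \<and> v \<in> e} \<rparr>"

definition total_dominating_set :: "'a pair_pre_digraph \<Rightarrow> 'a set \<Rightarrow> bool" where
  "total_dominating_set H D \<longleftrightarrow>
    D \<subseteq> pverts H \<and> (\<forall>v\<in>pverts H. \<exists>u\<in>D. (v, u) \<in> parcs H)"

text \<open>
  \<^const>\<open>connected\<close> is false for the graph without vertices, so \<open>D = pverts H\<close> is excluded.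
\<close>

definition total_outer_connected_dominating_set :: "'a pair_pre_digraph \<Rightarrow> 'a set \<Rightarrow> bool" where
  "total_outer_connected_dominating_set H D \<longleftrightarrow>
    total_dominating_set H D \<and> connected (with_proj H \<restriction> (pverts H - D))"

definition gamma_tc :: "'a pair_pre_digraph \<Rightarrow> nat" where
  "gamma_tc H = (LEAST k. \<exists>D. total_outer_connected_dominating_set H D \<and> card D = k)"

lemma pair_graph_spider_graph: "pair_graph (spider_graph n)"
  by unfold_locales (auto simp: spider_graph_def symmetric_def sym_def)

lemma pair_graph_middle_graph:
  assumes "pair_graph G"
  shows "pair_graph (middle_graph G)"
proof -
  interpret G: pair_graph G by (rule assms)
  have "undirected_edges G = (\<lambda>(u, v). {u, v}) ` parcs G"
    by (auto simp: undirected_edges_def)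
  then have fin: "finite (undirected_edges G)"
    using G.pair_finite_arcs by simp
  have finV: "finite (pverts (middle_graph G))"
    using fin G.pair_finite_verts by (simp add: middle_graph_def)
  have sub: "parcs (middle_graph G) \<subseteq> pverts (middle_graph G) \<times> pverts (middle_graph G)"
    by (auto simp: middle_graph_def)
  have finA: "finite (parcs (middle_graph G))"
    using finite_subset[OF sub] finV by simp
  show ?thesis
  proof unfold_locales
    show "symmetric (with_proj (middle_graph G))"
      by (auto simp: symmetric_def sym_def middle_graph_def)
    show "fst e \<noteq> snd e" if "e \<in> parcs (middle_graph G)" for e
      using that by (auto simp: middle_graph_def)
  qed (use sub finV finA in auto)
qed

end

theory Submission
  imports Defs
begin

text \<open>
  Write \<open>a\<^sub>i = v\<^sub>0v\<^sub>i\<close> and \<open>b\<^sub>i = v\<^sub>iv\<^sub>n\<^sub>+\<^sub>i\<close>. In the middle graph the leaf \<open>v\<^sub>n\<^sub>+\<^sub>i\<close> has \<open>b\<^sub>i\<close> as its only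
  neighbour, and \<open>v\<^sub>0\<close> has only the neighbours \<open>a\<^sub>j\<close>, so a total dominating set \<open>D\<close> contains every
  \<open>b\<^sub>i\<close> and some \<open>a\<^sub>j\<close>. All neighbours of the vertices \<open>v\<^sub>n\<^sub>+\<^sub>i\<close> and of \<open>v\<^sub>j\<close> now lie in \<open>D\<close>; a connected
  complement with more than one vertex has no isolated vertex, so these vertices lie in \<open>D\<close> as well,
  which makes \<open>2n + 2\<close> elements. A complement with a single vertex leaves \<open>4n\<close> elements in \<open>D\<close>.
  Conversely, the \<open>b\<^sub>i\<close> and \<open>v\<^sub>n\<^sub>+\<^sub>i\<close> together with \<open>a\<^sub>1\<close> and \<open>v\<^sub>1\<close> form an admissible set: \<open>v\<^sub>0\<close> is joined
  in its complement to each remaining \<open>v\<^sub>i\<close> through \<open>a\<^sub>i\<close>.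
\<close>

text \<open>\<open>connected\<close> is mutual reachability in \<open>mk_symmetric\<close> of the
  induced digraph. Arcs of a pair graph already come in both directions, so symmetrizing adds none,
  and \<open>rtrancl_on W\<close> by itself keeps walks inside \<open>W\<close>.\<close>

lemma connected_induce_subgraph_iff:
  assumes "pair_graph H"
  shows "connected (with_proj H \<restriction> W) \<longleftrightarrow>
    W \<noteq> {} \<and> (\<forall>u\<in>W. \<forall>v\<in>W. (u, v) \<in> rtrancl_on W (parcs H))"
proof -
  interpret pair_graph H by (rule assms)
  have sym: "(v, u) \<in> parcs H" if "(u, v) \<in> parcs H" for u v
    using that sym_arcs by (auto simp: symmetric_def sym_def)
  have "parcs (mk_symmetric (with_proj H \<restriction> W)) =
      (parcs H \<inter> W \<times> W) \<union> (parcs H \<inter> W \<times> W)\<inverse>"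
    by (force simp: parcs_mk_symmetric)
  also have "\<dots> = parcs H \<inter> W \<times> W"
    using sym by blast
  finally have parcs: "parcs (mk_symmetric (with_proj H \<restriction> W)) = parcs H \<inter> W \<times> W" .
  have "(u, v) \<in> rtrancl_on W (parcs H \<inter> W \<times> W) \<longleftrightarrow> (u, v) \<in> rtrancl_on W (parcs H)" for u v
  proof
    assume "(u, v) \<in> rtrancl_on W (parcs H \<inter> W \<times> W)"
    then show "(u, v) \<in> rtrancl_on W (parcs H)"
      by (rule rtrancl_on_mono[rotated 2]) auto
  next
    assume "(u, v) \<in> rtrancl_on W (parcs H)"
    then show "(u, v) \<in> rtrancl_on W (parcs H \<inter> W \<times> W)"
      by induct (auto intro: converse_rtrancl_on_into_rtrancl_on)
  qed
  then show ?thesis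
    by (auto simp: connected_def strongly_connected_def reachable_def parcs)
qed

text \<open>A walk inside the complement from \<open>x\<close> to a second vertex would start with
  an arc from \<open>x\<close> whose head lies outside \<open>D\<close>, against
  \<open>isolated\<close>.\<close>

lemma connected_complement_isolated:
  assumes "pair_graph H"
    and "connected (with_proj H \<restriction> (pverts H - D))"
    and x: "x \<in> pverts H - D"
    and isolated: "\<And>y. (x, y) \<in> parcs H \<Longrightarrow> y \<in> D"
  shows "pverts H - D = {x}"
proof -
  have "y = x" if "y \<in> pverts H - D" for y
  proof -
    have "(x, y) \<in> rtrancl_on (pverts H - D) (parcs H)"
      using assms(2) x that by (simp add: connected_induce_subgraph_iff[OF assms(1)])
    then show ?thesis
      by (cases rule: converse_rtrancl_on_cases)
        (use isolated in \<open>auto dest: in_rtrancl_on_in_F\<close>)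
  qed
  with x show ?thesis by blast
qed

text \<open>Walks into the root can be reversed since the arcs are symmetric, so any two vertices
  are joined through \<open>r\<close>.\<close>

lemma connected_induce_subgraphI_root:
  assumes "pair_graph H" and "r \<in> W"
    and reach: "\<And>u. u \<in> W \<Longrightarrow> (u, r) \<in> rtrancl_on W (parcs H)"
  shows "connected (with_proj H \<restriction> W)"
proof -
  interpret pair_graph H by (rule assms(1))
  have "sym (parcs H)"
    using sym_arcs by (simp add: symmetric_def)
  then have "sym (rtrancl_on W (parcs H))"
    by (rule rtrancl_on_sym)
  then show ?thesis
    using assms(2) reach
    by (auto simp: connected_induce_subgraph_iff[OF assms(1)] intro: rtrancl_on_trans dest: symD)
qed

lemma undirected_edges_spider_graph:
  "undirected_edges (spider_graph n) = (\<lambda>i. {0, i}) ` {1..n} \<union> (\<lambda>i. {i, n + i}) ` {1..n}"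
  (is "?E = ?A \<union> ?B")
proof
  show "?E \<subseteq> ?A \<union> ?B"
    by (auto simp: undirected_edges_def spider_graph_def)
  show "?A \<union> ?B \<subseteq> ?E"
    by (fastforce simp: undirected_edges_def spider_graph_def)
qed

lemma pverts_spider_graph: "pverts (spider_graph n) = {0..2 * n}"
  by (simp add: spider_graph_def)

lemma inj_on_hub_edges: "inj_on (\<lambda>i::nat. {0, i}) {1..n}"
  by (auto simp: inj_on_def doubleton_eq_iff)

lemma inj_on_leg_edges: "inj_on (\<lambda>i::nat. {i, n + i}) {1..n}"
  by (auto simp: inj_on_def doubleton_eq_iff)

lemma card_pverts_middle_spider: "card (pverts (middle_graph (spider_graph n))) = 4 * n + 1"
proof -
  \<comment> \<open>Leg edges consist of positive numbers and so avoid the hub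
    \<open>0\<close>.\<close>
  have "(\<lambda>i. {0, i}) ` {1..n} \<inter> (\<lambda>i. {i, n + i}) ` {1..n} = {}"
    by (auto simp: doubleton_eq_iff)
  then have "card (undirected_edges (spider_graph n)) = 2 * n"
    by (simp add: undirected_edges_spider_graph card_Un_disjoint card_image
        inj_on_hub_edges inj_on_leg_edges del: One_nat_def)
  moreover have "finite (undirected_edges (spider_graph n))"
    by (simp add: undirected_edges_spider_graph)
  ultimately show ?thesis
    by (simp add: middle_graph_def pverts_spider_graph card_Plus flip: Plus_def)
qed

text \<open>The \<open>2 * n\<close> elements common to the extremal set and to every admissible set
  whose complement has more than one vertex.\<close>

definition leaves_and_leg_edges :: "nat \<Rightarrow> (nat + nat set) set" where
  "leaves_and_leg_edges n = (\<lambda>i. Inl (n + i)) ` {1..n} \<union> (\<lambda>i. Inr {i, n + i}) ` {1..n}"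

lemma card_leaves_and_leg_edges_insert:
  assumes "j \<in> {1..n}"
  shows "card (insert (Inr {0, j}) (insert (Inl j) (leaves_and_leg_edges n))) = 2 * n + 2"
proof -
  have "leaves_and_leg_edges n = ((+) n ` {1..n}) <+> ((\<lambda>i. {i, n + i}) ` {1..n})"
    unfolding leaves_and_leg_edges_def Plus_def image_image ..
  then have "card (leaves_and_leg_edges n) = 2 * n"
    by (simp add: card_Plus card_image inj_on_leg_edges del: One_nat_def)
  moreover have "finite (leaves_and_leg_edges n)"
    by (simp add: leaves_and_leg_edges_def)
  \<comment> \<open>Leaves have numbers above \<open>n\<close> and leg edges avoid \<open>0\<close>,
    so neither element is counted twice.\<close>
  moreover have "Inl j \<notin> leaves_and_leg_edges n" "Inr {0, j} \<notin> leaves_and_leg_edges n"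
    using assms by (auto simp: leaves_and_leg_edges_def doubleton_eq_iff)
  ultimately show ?thesis by simp
qed

lemma arc_leaf_iff:
  assumes "i \<in> {1..n}"
  shows "(Inl (n + i), y) \<in> parcs (middle_graph (spider_graph n)) \<longleftrightarrow> y = Inr {i, n + i}"
  using assms by (auto simp: middle_graph_def undirected_edges_spider_graph pverts_spider_graph)

lemma arc_hub_iff:
  "(Inl 0, y) \<in> parcs (middle_graph (spider_graph n)) \<longleftrightarrow> (\<exists>j\<in>{1..n}. y = Inr {0, j})"
  by (auto simp: middle_graph_def undirected_edges_spider_graph pverts_spider_graph)

lemma arc_knee_iff:
  assumes "i \<in> {1..n}"
  shows "(Inl i, y) \<in> parcs (middle_graph (spider_graph n)) \<longleftrightarrow>
    y = Inr {0, i} \<or> y = Inr {i, n + i}"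
  using assms by (auto simp: middle_graph_def undirected_edges_spider_graph pverts_spider_graph)

lemma pverts_middle_spider_cases:
  assumes "x \<in> pverts (middle_graph (spider_graph n))"
  obtains (hub) "x = Inl 0"
    | (knee) i where "i \<in> {1..n}" "x = Inl i"
    | (leaf) i where "i \<in> {1..n}" "x = Inl (n + i)"
    | (hub_edge) i where "i \<in> {1..n}" "x = Inr {0, i}"
    | (leg_edge) i where "i \<in> {1..n}" "x = Inr {i, n + i}"
proof -
  consider v where "v \<le> 2 * n" "x = Inl v"
    | i where "i \<in> {1..n}" "x = Inr {0, i}"
    | i where "i \<in> {1..n}" "x = Inr {i, n + i}"
    using assms
    by (auto simp: middle_graph_def undirected_edges_spider_graph pverts_spider_graph)
  then show thesis
  proof cases
    case (1 v)
    \<comment> \<open>A leaf \<open>v > n\<close> belongs to leg \<open>v - n\<close>, where the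
      subtraction does not truncate.\<close>
    then consider "v = 0" | "v \<in> {1..n}" | "v - n \<in> {1..n}" "v = n + (v - n)"
      by fastforce
    then show thesis using 1 hub knee leaf by cases metis+
  qed (use hub_edge leg_edge in blast)+
qed

lemma leaves_and_leg_edges_toc:
  assumes "n \<ge> 1"
  shows "total_outer_connected_dominating_set (middle_graph (spider_graph n))
    (insert (Inr {0, 1}) (insert (Inl 1) (leaves_and_leg_edges n)))"
    (is "total_outer_connected_dominating_set ?M ?D")
proof -
  have M: "pair_graph ?M"
    by (intro pair_graph_middle_graph pair_graph_spider_graph)
  have sub: "?D \<subseteq> pverts ?M"
    using assms
    by (auto simp: leaves_and_leg_edges_def middle_graph_def undirected_edges_spider_graph
        pverts_spider_graph)
  \<comment> \<open>The hub is dominated by \<open>Inr {0, 1}\<close>, every knee and leaf by its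
    leg edge, a hub edge by the leg edge sharing its knee, and a leg edge by its leaf.\<close>
  have dom: "\<exists>u\<in>?D. (x, u) \<in> parcs ?M" if "x \<in> pverts ?M" for x
    using that
  proof (cases rule: pverts_middle_spider_cases)
    case hub
    then show ?thesis using assms by (intro bexI[of _ "Inr {0, 1}"]) (auto simp: arc_hub_iff)
  next
    case (knee i)
    then show ?thesis
      by (intro bexI[of _ "Inr {i, n + i}"]) (auto simp: arc_knee_iff leaves_and_leg_edges_def)
  next
    case (leaf i)
    then show ?thesis
      by (intro bexI[of _ "Inr {i, n + i}"]) (auto simp: arc_leaf_iff leaves_and_leg_edges_def)
  next
    case (hub_edge i)
    then show ?thesis
      by (intro bexI[of _ "Inr {i, n + i}"])
        (auto simp: leaves_and_leg_edges_def middle_graph_def undirected_edges_spider_graph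
          doubleton_eq_iff)
  next
    case (leg_edge i)
    then show ?thesis
      by (intro bexI[of _ "Inl (n + i)"])
        (auto simp: leaves_and_leg_edges_def middle_graph_def undirected_edges_spider_graph
          pverts_spider_graph)
  qed
  let ?W = "pverts ?M - ?D"
  have hub: "Inl 0 \<in> ?W"
    using assms by (auto simp: leaves_and_leg_edges_def middle_graph_def pverts_spider_graph)
  have edge_in: "Inr {0, i} \<in> ?W" if "i \<in> {1..n}" "i \<noteq> 1" for i
    using that
    by (auto simp: leaves_and_leg_edges_def middle_graph_def undirected_edges_spider_graph
        doubleton_eq_iff)
  have edge_hub: "(Inr {0, i}, Inl 0) \<in> rtrancl_on ?W (parcs ?M)" if "i \<in> {1..n}" "i \<noteq> 1" for i
  proof (rule converse_rtrancl_on_into_rtrancl_on)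
    show "(Inr {0, i}, Inl 0) \<in> parcs ?M"
      using that
      by (auto simp: middle_graph_def undirected_edges_spider_graph pverts_spider_graph)
  qed (use hub edge_in that in auto)
  have "(x, Inl 0) \<in> rtrancl_on ?W (parcs ?M)" if x: "x \<in> ?W" for x
  proof -
    from x have "x \<in> pverts ?M" by blast
    then show ?thesis
    proof (cases rule: pverts_middle_spider_cases)
      case hub
      with x show ?thesis by (auto intro: rtrancl_on_refl)
    next
      case (knee i)
      with x have "i \<noteq> 1" by auto
      have "(Inl i, Inr {0, i}) \<in> parcs ?M"
        by (simp add: arc_knee_iff[OF knee(1)])
      then show ?thesis
        unfolding knee(2)
        by (rule converse_rtrancl_on_into_rtrancl_on)
          (use edge_hub knee \<open>i \<noteq> 1\<close> x in blast)+
    next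
      case (hub_edge i)
      with x have "i \<noteq> 1" by auto
      with hub_edge edge_hub show ?thesis by auto
    \<comment> \<open>All leaves and leg edges lie in \<open>?D\<close>, so these cases are
      void.\<close>
    qed (use x in \<open>auto simp: leaves_and_leg_edges_def\<close>)
  qed
  with M hub have "connected (with_proj ?M \<restriction> ?W)"
    by (rule connected_induce_subgraphI_root)
  with sub dom show ?thesis
    by (simp add: total_outer_connected_dominating_set_def total_dominating_set_def)
qed

text \<open>The terms of the minimum come from the two cases of a one-vertex complement and of a
  larger one.\<close>

lemma toc_card_lower_bound:
  assumes D: "total_outer_connected_dominating_set (middle_graph (spider_graph n)) D"
  shows "min (4 * n) (2 * n + 2) \<le> card D"
proof (cases "\<exists>x. pverts (middle_graph (spider_graph n)) - D = {x}")
  let ?M = "middle_graph (spider_graph n)"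
  interpret M: pair_graph ?M
    by (intro pair_graph_middle_graph pair_graph_spider_graph)
  have sub: "D \<subseteq> pverts ?M"
    and dom: "\<And>x. x \<in> pverts ?M \<Longrightarrow> \<exists>u\<in>D. (x, u) \<in> parcs ?M"
    and conn: "connected (with_proj ?M \<restriction> (pverts ?M - D))"
    using D by (auto simp: total_outer_connected_dominating_set_def total_dominating_set_def)
  have fin: "finite D"
    using sub by (rule finite_subset) (rule M.pair_finite_verts)
  {
    case True
    then have "card (pverts ?M - D) = 1" by auto
    then show ?thesis
      using card_Diff_subset[OF fin sub] card_pverts_middle_spider[of n] by simp
  next
    case False
    \<comment> \<open>Such an \<open>x\<close> outside \<open>D\<close> would be the whole
      complement, which this case excludes.\<close>
    have isolated: "x \<in> D" if "x \<in> pverts ?M" "\<And>y. (x, y) \<in> parcs ?M \<Longrightarrow> y \<in> D" for x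
      using connected_complement_isolated[OF M.pair_graph_axioms conn] that False by blast
    have verts: "Inl v \<in> pverts ?M" if "v \<le> 2 * n" for v
      using that by (simp add: middle_graph_def pverts_spider_graph)
    have leg: "Inr {i, n + i} \<in> D" if "i \<in> {1..n}" for i
      using dom[of "Inl (n + i)"] that verts by (auto simp: arc_leaf_iff)
    have leaf: "Inl (n + i) \<in> D" if "i \<in> {1..n}" for i
      using that leg by (auto simp: arc_leaf_iff intro!: isolated[of "Inl (n + i)"] verts)
    obtain j where j: "j \<in> {1..n}" "Inr {0, j} \<in> D"
      using dom[of "Inl 0"] verts by (auto simp: arc_hub_iff)
    then have "Inl j \<in> D"
      using leg by (auto simp: arc_knee_iff intro!: isolated[of "Inl j"] verts)
    with j leg leaf have "insert (Inr {0, j}) (insert (Inl j) (leaves_and_leg_edges n)) \<subseteq> D"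
      by (auto simp: leaves_and_leg_edges_def)
    from card_mono[OF fin this] show ?thesis
      by (simp add: card_leaves_and_leg_edges_insert[OF j(1)])
  }
qed

theorem theorem4p8:
  fixes n :: nat
  assumes "n \<ge> 3"
  shows "gamma_tc (middle_graph (spider_graph n)) = 2 * n + 2"
  unfolding gamma_tc_def
proof (rule Least_equality)
  show "\<exists>D. total_outer_connected_dominating_set (middle_graph (spider_graph n)) D
    \<and> card D = 2 * n + 2"
    using assms leaves_and_leg_edges_toc[of n] card_leaves_and_leg_edges_insert[of 1 n] by auto
next
  fix k
  assume "\<exists>D. total_outer_connected_dominating_set (middle_graph (spider_graph n)) D \<and> card D = k"
  \<comment> \<open>Here \<open>2 * n + 2 \<le> 4 * n\<close>, so the minimum is its second
    term.\<close>
  then show "2 * n + 2 \<le> k"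
    using assms toc_card_lower_bound[of n] by fastforce
qed

end
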